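(* Let $p>3$ be a prime. Then $$\sum_{k=0}^{\frac{p-1}{2}} (6k+1) \left(\frac{(\frac12)_k}{k!}\right)^3 \frac{(-1)^k}{8^k}\equiv (-1)^{\frac{p^2-1}{8}+\frac{p-1}{2}}p \pmod{p^2}.$$
   Context: For $a\in\mathbb{C}$ and $k\in\mathbb{N}$, $(a)_k=a(a+1)\cdots(a+k-1)$ denotes the rising factorial, with $(a)_0=1$. A congruence $A\equiv B \pmod{p^m}$ between rational numbers means that $A-B\in p^m\mathbb{Z}_{(p)}$. *)

theory Defs
  imports Complex_Main "HOL-Computational_Algebra.Primes"
begin

text \<open>The localization of the integers at the prime ideal generated by \<open>p\<close>, as a set of rationals.\<close>

definition Z_localized :: "nat \<Rightarrow> rat set" where
  "Z_localized p = {of_int a / of_int b | a b :: int. \<not> int p dvd b}"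

definition rat_cong :: "rat \<Rightarrow> rat \<Rightarrow> nat \<Rightarrow> nat \<Rightarrow> bool" where
  "rat_cong A B p m \<longleftrightarrow> (\<exists>c \<in> Z_localized p. A - B = of_nat (p ^ m) * c)"

end

theory Submission
  imports Defs
begin

text \<open>
  Write $p = 2n + 1$. Replacing $(1/2)_k^3 / k!^3$ by
  $(1/2)_k (1/2 - x)_k (1/2 + x)_k / (k!\,(1 + x/2)_k (1 - x/2)_k)$ gives a sum that is even in $x$,
  so at $x = p/2$ its terms agree with the original ones modulo $p^2$. At this point the sum
  terminates by itself, since $(1/2 - x)_k = (-n)_k$, and a Gosper-summable recurrence from $n$
  to $n + 2$ shows that it equals exactly $(-1)^{\lfloor n/2 \rfloor} (2n + 1)$.
\<close>

section \<open>A terminating hypergeometric sum\<close>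

text \<open>Both sides equal \<open>pochhammer a (Suc k)\<close>, with either its first or its last
  factor split off.\<close>

lemma pochhammer_shift:
  fixes a :: "'a::comm_ring_1"
  shows "a * pochhammer (a + 1) k = pochhammer a k * (a + of_nat k)"
  using pochhammer_rec[of a k] pochhammer_Suc[of a k] by simp

lemma pochhammer_shift2:
  fixes a :: "'a::comm_ring_1"
  shows "a * (a + 1) * pochhammer (a + 2) k
    = pochhammer a k * (a + of_nat k) * (a + 1 + of_nat k)"
proof -
  have "a * (a + 1) * pochhammer (a + 2) k = a * ((a + 1) * pochhammer (a + 1 + 1) k)"
    by (simp add: mult.assoc add.assoc)
  also have "\<dots> = a * pochhammer (a + 1) k * (a + 1 + of_nat k)"
    unfolding pochhammer_shift[of "a + 1"] by (simp only: mult.assoc)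
  finally show ?thesis by (simp only: pochhammer_shift)
qed

text \<open>The deformed term at x = n + 1/2: there 1/2 - x = -n, 1/2 + x = n + 1, 1 + x/2 = n/2 +
  5/4 and 1 - x/2 = 3/4 - n/2.\<close>

definition strange_term :: "nat \<Rightarrow> nat \<Rightarrow> rat" where
  "strange_term n k = (6 * of_nat k + 1)
     * (pochhammer (1/2) k * pochhammer (- of_nat n) k * pochhammer (of_nat n + 1) k)
     / (fact k * pochhammer (of_nat n / 2 + 5/4) k * pochhammer (3/4 - of_nat n / 2) k)
     * (-1/8) ^ k"

text \<open>
  The terms for $n$ and $n + 2$ are both polynomial multiples of the following one; dividing one
  by the other directly would have poles at $k = n + 1$ and $k = n + 2$.
\<close>

definition strange_base :: "nat \<Rightarrow> nat \<Rightarrow> rat" where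
  "strange_base n k =
     (pochhammer (1/2) k * pochhammer (- of_nat n - 2) k * pochhammer (of_nat n + 1) k)
     / (fact k * pochhammer (of_nat n / 2 + 9/4) k * pochhammer (3/4 - of_nat n / 2) k)
     * (-1/8) ^ k"

lemma of_int_odd_neq_0: "odd i \<Longrightarrow> (of_int i :: rat) \<noteq> 0"
  by auto

text \<open>Covers the denominators, whose parameters such as (2n + 5)/4 and (3 - 2n)/4 may be
  negative: a vanishing factor would make the odd integer \<open>i + 4 * j\<close> zero.\<close>

lemma pochhammer_odd_quarter_neq_0:
  assumes "odd i"
  shows "pochhammer (of_int i / 4 :: rat) k \<noteq> 0"
proof
  assume "pochhammer (of_int i / 4 :: rat) k = 0"
  then obtain j where "(of_int i / 4 :: rat) = - of_nat j"
    by (auto simp: pochhammer_eq_0_iff)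
  then have "(of_int (i + 4 * int j) :: rat) = 0" by simp
  moreover have "odd (i + 4 * int j)" using assms by simp
  ultimately show False using of_int_odd_neq_0 by blast
qed

lemma strange_base_Suc:
  "strange_base n (Suc k) * ((of_nat k + 1) * (4 * of_nat k + 2 * of_nat n + 9)
       * (4 * of_nat k - 2 * of_nat n + 3))
   = - strange_base n k * ((2 * of_nat k + 1) * (of_nat k - of_nat n - 2) * (of_nat k + of_nat n + 1))"
proof -
  define K N :: rat where "K = of_nat k" and "N = of_nat n"
  have nz: "K + 1 \<noteq> 0" "4 * K + 2 * N + 9 \<noteq> 0" "4 * K - 2 * N + 3 \<noteq> 0"
    using of_int_odd_neq_0[of "4 * int k + 2 * int n + 9"]
      of_int_odd_neq_0[of "4 * int k - 2 * int n + 3"] of_nat_0_le_iff[of k, where ?'a = rat]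
    unfolding K_def N_def by simp_all
  have quarter: "N / 2 + 9/4 + K = (4 * K + 2 * N + 9) / 4" "3/4 - N / 2 + K = (4 * K - 2 * N + 3) / 4"
    "1/2 + K = (2 * K + 1) / 2" "- N - 2 + K = K - N - 2" "N + 1 + K = K + N + 1" "1 + K = K + 1"
    by (simp_all add: field_simps)
  \<comment> \<open>The Pochhammer symbols, factorial and power become letters. The constants
    collect to (1/2) * 16 * (-1/8) = -1. If \<open>f\<close>, \<open>d\<close> or \<open>e\<close>
    is 0, both sides are 0 since division by 0 gives 0.\<close>
  have cancel: "a * (u / 2) * (b * v) * (c * w) / (z * f * (d * (x / 4)) * (e * (y / 4)))
      * (-1/8 * r) * (z * x * y) = - (a * b * c / (f * d * e) * r) * (u * v * w)"
    if "z \<noteq> 0" "x \<noteq> 0" "y \<noteq> 0" for a b c d e f r u v w x y z :: rat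
    using that by (cases "f = 0 \<or> d = 0 \<or> e = 0") (auto simp: field_simps)
  show ?thesis
    unfolding strange_base_def pochhammer_Suc fact_Suc power_Suc of_nat_Suc K_def[symmetric]
      N_def[symmetric] quarter
    using nz by (rule cancel)
qed

text \<open>Each term differs from the base in only two Pochhammer symbols: -n and n/2 + 5/4 for n,
  n + 3 and -1/4 - n/2 for n + 2. Shifting these yields polynomials in k; the factors on the left
  clear denominators, so that no value of k is exceptional.\<close>

lemma strange_term_eq_base:
  "(2 * of_nat n + 5) * (of_nat n + 1) * (of_nat n + 2) * strange_term n k
   = strange_base n k * (6 * of_nat k + 1) * (of_nat n + 1 - of_nat k) * (of_nat n + 2 - of_nat k)
     * (4 * of_nat k + 2 * of_nat n + 5)"
  (is ?term)
  and strange_term_add_2_eq_base: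
  "(2 * of_nat n + 1) * (of_nat n + 1) * (of_nat n + 2) * strange_term (n + 2) k
   = strange_base n k * (6 * of_nat k + 1) * (of_nat n + 1 + of_nat k) * (of_nat n + 2 + of_nat k)
     * (2 * of_nat n + 1 - 4 * of_nat k)"
  (is ?term2)
proof -
  define K N :: rat where "K = of_nat k" and "N = of_nat n"
  note fold = K_def[symmetric] N_def[symmetric]
  define A A' B B' C C' D D' H where defs:
    "A = pochhammer (- N) k" "A' = pochhammer (- N - 2) k"
    "B = pochhammer (N + 1) k" "B' = pochhammer (N + 3) k"
    "C = pochhammer (N / 2 + 5/4) k" "C' = pochhammer (N / 2 + 9/4) k"
    "D = pochhammer (3/4 - N / 2) k" "D' = pochhammer (- 1/4 - N / 2) k"
    "H = pochhammer (1/2) k / fact k * (-1/8 :: rat) ^ k"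
  have nz: "C \<noteq> 0" "C' \<noteq> 0" "D \<noteq> 0" "D' \<noteq> 0"
    using pochhammer_odd_quarter_neq_0[of "2 * int n + 5" k]
      pochhammer_odd_quarter_neq_0[of "2 * int n + 9" k]
      pochhammer_odd_quarter_neq_0[of "3 - 2 * int n" k]
      pochhammer_odd_quarter_neq_0[of "- 1 - 2 * int n" k]
    unfolding defs N_def by (simp_all add: add_divide_distrib diff_divide_distrib add.commute)
  have A: "(N + 1) * (N + 2) * A = A' * (N + 1 - K) * (N + 2 - K)"
    using pochhammer_shift2[of "- N - 2" k] unfolding defs fold by (simp add: algebra_simps)
  have B: "(N + 1) * (N + 2) * B' = B * (N + 1 + K) * (N + 2 + K)"
    using pochhammer_shift2[of "N + 1" k] unfolding defs fold by (simp add: algebra_simps)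
  have C: "(2 * N + 5) * C' = C * (4 * K + 2 * N + 5)"
    using pochhammer_shift[of "N / 2 + 5/4" k] unfolding defs fold by (simp add: field_simps)
  have D: "(2 * N + 1) * D = D' * (2 * N + 1 - 4 * K)"
    using pochhammer_shift[of "- 1/4 - N / 2" k] unfolding defs fold by (simp add: field_simps)
  have base: "strange_base n k = H * (A' * B) / (C' * D)"
    unfolding strange_base_def defs fold by (simp add: mult_ac)
  have term1: "strange_term n k = (6 * K + 1) * H * (A * B) / (C * D)"
    unfolding strange_term_def defs fold by (simp add: mult_ac)
  have "(2 * N + 5) * (N + 1) * (N + 2) * strange_term n k
      = (6 * K + 1) * H * (((N + 1) * (N + 2) * A) * B) * ((2 * N + 5) * C') / (C * C' * D)"
    unfolding term1 using nz by (simp add: divide_simps)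
  also have "\<dots> = strange_base n k * (6 * K + 1) * (N + 1 - K) * (N + 2 - K) * (4 * K + 2 * N + 5)"
    unfolding A C base using nz by (simp add: divide_simps)
  finally show ?term unfolding K_def N_def .
  have term2: "strange_term (n + 2) k = (6 * K + 1) * H * (A' * B') / (C' * D')"
  proof -
    have shift: "- (N + 2) = - N - 2" "N + 2 + 1 = N + 3" "(N + 2) / 2 + 5/4 = N / 2 + 9/4"
      "3/4 - (N + 2) / 2 = - 1/4 - N / 2"
      by (simp_all add: field_simps)
    show ?thesis
      unfolding strange_term_def of_nat_add of_nat_numeral fold shift by (simp add: defs mult_ac)
  qed
  have "(2 * N + 1) * (N + 1) * (N + 2) * strange_term (n + 2) k
      = (6 * K + 1) * H * (A' * ((N + 1) * (N + 2) * B')) * ((2 * N + 1) * D) / (C' * D * D')"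
    unfolding term2 using nz by (simp add: divide_simps)
  also have "\<dots> = strange_base n k * (6 * K + 1) * (N + 1 + K) * (N + 2 + K) * (2 * N + 1 - 4 * K)"
    unfolding B D base using nz by (simp add: divide_simps)
  finally show ?term2 unfolding K_def N_def .
qed

text \<open>The antidifference in k behind the recurrence. At k + 1 its three k-dependent factors
  become exactly the multiplier of \<open>strange_base n (Suc k)\<close> in
  \<open>strange_base_Suc\<close>; the constant 4n + 6 is fixed by comparing coefficients of k^3 in
  the telescoping identity.\<close>

definition gosper_certificate :: "nat \<Rightarrow> nat \<Rightarrow> rat" where
  "gosper_certificate n k = (4 * of_nat n + 6) * of_nat k
     * (4 * of_nat k + 2 * of_nat n + 5) * (4 * of_nat k - 2 * of_nat n - 1) * strange_base n k"

text \<open>Once everything is expressed through \<open>strange_base n k\<close>, this is a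
  polynomial identity in n and k.\<close>

lemma strange_term_telescope:
  "(of_nat n + 1) * (of_nat n + 2)
     * ((2 * of_nat n + 1) * strange_term (n + 2) k + (2 * of_nat n + 5) * strange_term n k)
   = gosper_certificate n (Suc k) - gosper_certificate n k"
proof -
  define K N h :: rat where "K = of_nat k" and "N = of_nat n" and "h = strange_base n k"
  note fold = K_def[symmetric] N_def[symmetric] h_def[symmetric]
  have identity: "- (4 * N + 6) * h * ((2 * K + 1) * (K - N - 2) * (K + N + 1))
      - (4 * N + 6) * K * (4 * K + 2 * N + 5) * (4 * K - 2 * N - 1) * h
     = h * (6 * K + 1) * (N + 1 + K) * (N + 2 + K) * (2 * N + 1 - 4 * K)
       + h * (6 * K + 1) * (N + 1 - K) * (N + 2 - K) * (4 * K + 2 * N + 5)"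
    by algebra
  have certificate_k: "gosper_certificate n k
      = (4 * N + 6) * K * (4 * K + 2 * N + 5) * (4 * K - 2 * N - 1) * h"
    unfolding gosper_certificate_def fold ..
  have "gosper_certificate n (Suc k) = (4 * N + 6) * (strange_base n (Suc k)
      * ((K + 1) * (4 * K + 2 * N + 9) * (4 * K - 2 * N + 3)))"
    unfolding gosper_certificate_def of_nat_Suc fold by (simp add: algebra_simps)
  also have "\<dots> = - (4 * N + 6) * h * ((2 * K + 1) * (K - N - 2) * (K + N + 1))"
    using strange_base_Suc[of n k] unfolding fold
    by (simp only: mult_minus_left mult_minus_right mult.assoc)
  finally have "gosper_certificate n (Suc k) - gosper_certificate n k
     = h * (6 * K + 1) * (N + 1 + K) * (N + 2 + K) * (2 * N + 1 - 4 * K)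
       + h * (6 * K + 1) * (N + 1 - K) * (N + 2 - K) * (4 * K + 2 * N + 5)"
    unfolding certificate_k by (simp only: identity)
  also have "\<dots> = (N + 1) * (N + 2)
     * ((2 * N + 1) * strange_term (n + 2) k + (2 * N + 5) * strange_term n k)"
    using strange_term_eq_base[of n k] strange_term_add_2_eq_base[of n k]
    unfolding fold by (simp add: algebra_simps)
  finally show ?thesis unfolding K_def N_def by simp
qed

lemma strange_term_eq_0: "n < k \<Longrightarrow> strange_term n k = 0"
  by (simp add: strange_term_def pochhammer_of_nat_eq_0_lemma)

text \<open>Summing the telescoped relation over k \<le> n + 2 leaves the certificate at k = 0, zero
  by its factor k, and at k = n + 3, zero because (-n-2)_(n+3) = 0.\<close>

lemma sum_strange_term_rec:
  "(2 * of_nat n + 1) * (\<Sum>k\<le>n + 2. strange_term (n + 2) k)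
   = - (2 * of_nat n + 5) * (\<Sum>k\<le>n. strange_term n k)"
proof -
  have neg: "(- of_nat (n + 2) :: rat) = - of_nat n - 2" by simp
  have "pochhammer (- of_nat (n + 2) :: rat) (Suc (n + 2)) = 0"
    by (rule pochhammer_of_nat_eq_0_lemma) simp
  then have "gosper_certificate n (Suc (n + 2)) = 0"
    unfolding neg by (simp add: gosper_certificate_def strange_base_def)
  \<comment> \<open>\<open>sum_telescope\<close> is stated for the opposite difference, hence the
    sign change through \<open>sum_negf\<close>.\<close>
  then have "(\<Sum>k\<le>n + 2. gosper_certificate n (Suc k) - gosper_certificate n k) = 0"
    using sum_telescope[of "gosper_certificate n" "n + 2"]
      sum_negf[of "\<lambda>k. gosper_certificate n k - gosper_certificate n (Suc k)" "{..n + 2}"]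
    by (simp add: gosper_certificate_def)
  then have "(of_nat n + 1) * (of_nat n + 2) * ((2 * of_nat n + 1) * (\<Sum>k\<le>n + 2. strange_term (n + 2) k)
      + (2 * of_nat n + 5) * (\<Sum>k\<le>n + 2. strange_term n k)) = 0"
    by (simp only: strange_term_telescope[symmetric] sum_distrib_left[symmetric] sum.distrib)
  moreover have "(of_nat n + 1) * (of_nat n + 2 :: rat) \<noteq> 0"
    using of_nat_0_le_iff[of n, where ?'a = rat] by auto
  moreover have "(\<Sum>k\<le>n + 2. strange_term n k) = (\<Sum>k\<le>n. strange_term n k)"
    by (simp add: strange_term_eq_0)
  ultimately show ?thesis
    by (simp only: mult_eq_0_iff) (simp add: algebra_simps add_eq_0_iff)
qed

text \<open>Each step of 2 multiplies the sum by -(2n + 5)/(2n + 1); the starting values are 1 at n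
  = 0 and 3 at n = 1.\<close>

theorem sum_strange_term: "(\<Sum>k\<le>n. strange_term n k) = (-1) ^ (n div 2) * (2 * of_nat n + 1)"
proof (induction n rule: nat_induct2)
  case (step n)
  have "(2 * of_nat n + 1 :: rat) \<noteq> 0"
    using of_nat_0_le_iff[of n, where ?'a = rat] by linarith
  moreover have "(2 * of_nat n + 1) * (\<Sum>k\<le>n + 2. strange_term (n + 2) k)
      = (2 * of_nat n + 1) * ((-1) ^ ((n + 2) div 2) * (2 * of_nat (n + 2) + 1))"
    unfolding sum_strange_term_rec step by (simp add: algebra_simps)
  ultimately show ?case by (simp only: mult_cancel_left) simp
qed (simp_all add: strange_term_def)

section \<open>Congruences in the localization\<close>

lemma Z_localizedI: "\<not> int p dvd b \<Longrightarrow> of_int a / of_int b \<in> Z_localized p"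
  unfolding Z_localized_def by blast

lemma of_int_in_Z_localized: "prime p \<Longrightarrow> of_int a \<in> Z_localized p"
  using Z_localizedI[of p 1 a] by (auto dest: prime_gt_1_nat)

lemma Z_localized_add:
  assumes "prime p" "x \<in> Z_localized p" "y \<in> Z_localized p"
  shows "x + y \<in> Z_localized p"
proof -
  from assms obtain a b c d where
    x: "x = of_int a / of_int b" "\<not> int p dvd b" and y: "y = of_int c / of_int d" "\<not> int p dvd d"
    unfolding Z_localized_def by blast
  have "b \<noteq> 0" "d \<noteq> 0" using x y by auto
  then have "x + y = of_int (a * d + c * b) / of_int (b * d)"
    by (simp add: x y field_simps)
  moreover have "\<not> int p dvd b * d" using x y assms(1) by (simp add: prime_dvd_mult_iff)
  ultimately show ?thesis using Z_localizedI by metis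
qed

lemma Z_localized_mult:
  assumes "prime p" "x \<in> Z_localized p" "y \<in> Z_localized p"
  shows "x * y \<in> Z_localized p"
proof -
  from assms obtain a b c d where
    x: "x = of_int a / of_int b" "\<not> int p dvd b" and y: "y = of_int c / of_int d" "\<not> int p dvd d"
    unfolding Z_localized_def by blast
  have "x * y = of_int (a * c) / of_int (b * d)" by (simp add: x y)
  moreover have "\<not> int p dvd b * d" using x y assms(1) by (simp add: prime_dvd_mult_iff)
  ultimately show ?thesis using Z_localizedI by metis
qed

lemma Z_localized_power: "prime p \<Longrightarrow> x \<in> Z_localized p \<Longrightarrow> x ^ k \<in> Z_localized p"
  using of_int_in_Z_localized[of p 1] by (induction k) (simp_all add: Z_localized_mult)

lemma Z_localized_prod:
  "prime p \<Longrightarrow> (\<And>i. i \<in> I \<Longrightarrow> f i \<in> Z_localized p) \<Longrightarrow> prod f I \<in> Z_localized p"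
  using of_int_in_Z_localized[of p 1]
  by (induction I rule: infinite_finite_induct) (simp_all add: Z_localized_mult)

lemma rat_cong_refl: "prime p \<Longrightarrow> rat_cong x x p m"
  unfolding rat_cong_def using of_int_in_Z_localized[of p 0] by auto

lemma rat_cong_add:
  assumes "prime p" "rat_cong x y p m" "rat_cong z w p m"
  shows "rat_cong (x + z) (y + w) p m"
proof -
  obtain c d where "c \<in> Z_localized p" "d \<in> Z_localized p"
    "x - y = of_nat (p ^ m) * c" "z - w = of_nat (p ^ m) * d"
    using assms unfolding rat_cong_def by blast
  moreover from this have "x + z - (y + w) = of_nat (p ^ m) * (c + d)"
    by (simp add: algebra_simps)
  ultimately show ?thesis unfolding rat_cong_def using Z_localized_add[OF assms(1)] by blast
qed

text \<open>From x z - y w = (x - y) z + y (z - w), which is why integrality is asked of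
  \<open>y\<close> and \<open>z\<close>.\<close>

lemma rat_cong_mult:
  assumes "prime p" "rat_cong x y p m" "rat_cong z w p m" "y \<in> Z_localized p" "z \<in> Z_localized p"
  shows "rat_cong (x * z) (y * w) p m"
proof -
  obtain c d where cd: "c \<in> Z_localized p" "d \<in> Z_localized p"
    "x - y = of_nat (p ^ m) * c" "z - w = of_nat (p ^ m) * d"
    using assms unfolding rat_cong_def by blast
  have "x * z - y * w = (x - y) * z + y * (z - w)" by (simp add: algebra_simps)
  also have "\<dots> = of_nat (p ^ m) * (c * z + y * d)" unfolding cd by (simp add: algebra_simps)
  finally show ?thesis unfolding rat_cong_def
    using cd assms by (blast intro: Z_localized_add Z_localized_mult)
qed

lemma rat_cong_sum:
  "prime p \<Longrightarrow> (\<And>i. i \<in> I \<Longrightarrow> rat_cong (f i) (g i) p m) \<Longrightarrow> rat_cong (sum f I) (sum g I) p m"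
  by (induction I rule: infinite_finite_induct) (simp_all add: rat_cong_add rat_cong_refl)

lemma rat_cong_prod:
  assumes "prime p" "\<And>i. i \<in> I \<Longrightarrow> rat_cong (f i) (g i) p m"
    and "\<And>i. i \<in> I \<Longrightarrow> f i \<in> Z_localized p" "\<And>i. i \<in> I \<Longrightarrow> g i \<in> Z_localized p"
  shows "rat_cong (prod f I) (prod g I) p m"
  using assms(2-)
  by (induction I rule: infinite_finite_induct)
    (simp_all add: rat_cong_refl rat_cong_mult Z_localized_prod assms(1))

section \<open>The supercongruence\<close>

text \<open>Integer numerators and denominators make \<open>Z_localizedI\<close> applicable factor
  by factor.\<close>

lemma pochhammer_half_div_fact:
  "pochhammer (1/2 :: rat) k / fact k = (\<Prod>j<k. of_int (2 * int j + 1) / of_int (2 * (int j + 1)))"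
proof (induction k)
  case (Suc k)
  have "pochhammer (1/2 :: rat) (Suc k) / fact (Suc k)
      = pochhammer (1/2) k / fact k * ((1/2 + of_nat k) / of_nat (Suc k))"
    by (simp add: pochhammer_Suc)
  also have "(1/2 + of_nat k) / of_nat (Suc k) = (of_int (2 * int k + 1) / of_int (2 * (int k + 1)) :: rat)"
    by (simp add: field_simps del: of_nat_Suc) (simp add: algebra_simps)
  finally show ?case unfolding Suc by simp
qed simp

text \<open>With n = (p - 1)/2, the factors pair up as ((2j + 1) - p)((2j + 1) + p)/4 above and (4(j
  + 1) - p)(4(j + 1) + p)/16 below, so p enters only through its square.\<close>

lemma strange_term_prod:
  assumes "p = 2 * n + 1"
  shows "strange_term n k = (6 * of_nat k + 1) * (pochhammer (1/2) k / fact k)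
    * (\<Prod>j<k. of_int (4 * ((2 * int j + 1)\<^sup>2 - (int p)\<^sup>2))
         / of_int (16 * (int j + 1)\<^sup>2 - (int p)\<^sup>2)) * (-1/8) ^ k"
proof -
  define P N :: rat where "P = of_nat p" and "N = of_nat n"
  have N: "N = (P - 1) / 2" using assms by (simp add: P_def N_def)
  have "pochhammer (- N) k * pochhammer (N + 1) k
       / (pochhammer (N / 2 + 5/4) k * pochhammer (3/4 - N / 2) k)
     = (\<Prod>j<k. ((- N + of_nat j) * (N + 1 + of_nat j))
         / ((N / 2 + 5/4 + of_nat j) * (3/4 - N / 2 + of_nat j)))"
    by (simp add: pochhammer_prod prod_dividef prod.distrib atLeast0LessThan)
  also have "\<dots> = (\<Prod>j<k. of_int (4 * ((2 * int j + 1)\<^sup>2 - (int p)\<^sup>2))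
         / of_int (16 * (int j + 1)\<^sup>2 - (int p)\<^sup>2))"
  proof (rule prod.cong[OF refl])
    fix j
    define J :: rat where "J = of_nat j"
    have factors: "(- N + J) * (N + 1 + J) = ((2 * J + 1)\<^sup>2 - P\<^sup>2) / 4"
      "(N / 2 + 5/4 + J) * (3/4 - N / 2 + J) = (16 * (J + 1)\<^sup>2 - P\<^sup>2) / 16"
      unfolding N by (simp_all add: field_simps power2_eq_square)
    have quot: "(a / 4) / (b / 16) = 4 * a / b" for a b :: rat by simp
    show "((- N + of_nat j) * (N + 1 + of_nat j))
         / ((N / 2 + 5/4 + of_nat j) * (3/4 - N / 2 + of_nat j))
       = of_int (4 * ((2 * int j + 1)\<^sup>2 - (int p)\<^sup>2)) / of_int (16 * (int j + 1)\<^sup>2 - (int p)\<^sup>2)"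
      unfolding J_def[symmetric] factors quot by (simp add: J_def P_def)
  qed
  finally show ?thesis unfolding strange_term_def N_def[symmetric]
    by (rule subst) (simp add: mult_ac)
qed

text \<open>Replacing p^2 by 0 in the second quotient gives the first, so the difference carries a
  factor p^2. The remaining denominator is prime to p because p is odd and j + 1 < p.\<close>

lemma deformed_factor_cong:
  assumes "prime p" "odd p" "j + 1 < p"
  shows "rat_cong ((of_int (2 * int j + 1) / of_int (2 * (int j + 1)))\<^sup>2)
      (of_int (4 * ((2 * int j + 1)\<^sup>2 - (int p)\<^sup>2)) / of_int (16 * (int j + 1)\<^sup>2 - (int p)\<^sup>2)) p 2"
    and "\<not> int p dvd 2 * (int j + 1)"
    and "\<not> int p dvd 16 * (int j + 1)\<^sup>2 - (int p)\<^sup>2"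
proof -
  have prime: "prime (int p)" using assms by simp
  have "\<not> int p dvd 2"
    using assms prime_ge_2_nat[of p] zdvd_imp_le[of "int p" 2] by (cases "p = 2") auto
  moreover have "\<not> int p dvd int j + 1"
    using assms zdvd_imp_le[of "int p" "int j + 1"] by auto
  ultimately show 2: "\<not> int p dvd 2 * (int j + 1)"
    using prime by (simp only: prime_dvd_mult_iff simp_thms)
  \<comment> \<open>As a square of known factors, this inherits non-divisibility by p from 2 and 2(j
    + 1).\<close>
  have sq: "16 * (int j + 1)\<^sup>2 = (2 * (2 * (int j + 1)))\<^sup>2" by (simp add: power2_eq_square algebra_simps)
  have "\<not> int p dvd 16 * (int j + 1)\<^sup>2"
    unfolding sq using prime 2 \<open>\<not> int p dvd 2\<close>
    by (simp only: prime_dvd_power_iff prime_dvd_mult_iff) simp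
  moreover have "int p dvd (int p)\<^sup>2" by (simp add: power2_eq_square)
  ultimately show 3: "\<not> int p dvd 16 * (int j + 1)\<^sup>2 - (int p)\<^sup>2"
    using dvd_diff_left_iff by blast
  define J P :: rat where "J = of_nat j" and "P = of_nat p"
  \<comment> \<open>This is the difference of the two quotients over a common denominator, divided
    by p^2.\<close>
  define c :: rat where "c = of_int (16 * (int j + 1)\<^sup>2 - (2 * int j + 1)\<^sup>2)
    / of_int ((2 * (int j + 1)) * (2 * (int j + 1)) * (16 * (int j + 1)\<^sup>2 - (int p)\<^sup>2))"
  have "c \<in> Z_localized p"
    unfolding c_def using prime 2 3 by (intro Z_localizedI) (simp only: prime_dvd_mult_iff simp_thms)
  moreover have nz: "J + 1 \<noteq> 0" "16 * (J + 1)\<^sup>2 - P\<^sup>2 \<noteq> 0"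
  proof -
    show "J + 1 \<noteq> 0" using of_nat_0_le_iff[of j, where ?'a = rat] unfolding J_def by linarith
    have "16 * (int j + 1)\<^sup>2 - (int p)\<^sup>2 \<noteq> 0" using 3 by (metis dvd_0_right)
    then have "(of_int (16 * (int j + 1)\<^sup>2 - (int p)\<^sup>2) :: rat) \<noteq> 0"
      by (simp only: of_int_eq_0_iff not_False_eq_True)
    then show "16 * (J + 1)\<^sup>2 - P\<^sup>2 \<noteq> 0" by (simp add: J_def P_def)
  qed
  have "((2 * J + 1) / (2 * (J + 1)))\<^sup>2 - 4 * ((2 * J + 1)\<^sup>2 - P\<^sup>2) / (16 * (J + 1)\<^sup>2 - P\<^sup>2)
      = P\<^sup>2 * ((16 * (J + 1)\<^sup>2 - (2 * J + 1)\<^sup>2)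
        / ((2 * (J + 1)) * (2 * (J + 1)) * (16 * (J + 1)\<^sup>2 - P\<^sup>2)))"
  proof -
    define X Y where "X = J + 1" and "Y = 16 * (J + 1)\<^sup>2 - P\<^sup>2"
    have "X \<noteq> 0" "Y \<noteq> 0" using nz by (simp_all add: X_def Y_def)
    have "((2 * J + 1) / (2 * X))\<^sup>2 - 4 * ((2 * J + 1)\<^sup>2 - P\<^sup>2) / Y
      = ((2 * J + 1)\<^sup>2 * Y - 16 * X\<^sup>2 * ((2 * J + 1)\<^sup>2 - P\<^sup>2)) / ((2 * X) * (2 * X) * Y)"
      using \<open>X \<noteq> 0\<close> \<open>Y \<noteq> 0\<close> by (simp add: field_simps power2_eq_square)
    also have "(2 * J + 1)\<^sup>2 * Y - 16 * X\<^sup>2 * ((2 * J + 1)\<^sup>2 - P\<^sup>2)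
      = P\<^sup>2 * (16 * X\<^sup>2 - (2 * J + 1)\<^sup>2)"
      unfolding X_def Y_def by algebra
    finally show ?thesis unfolding X_def Y_def by simp
  qed
  then have "(of_int (2 * int j + 1) / of_int (2 * (int j + 1)))\<^sup>2
      - of_int (4 * ((2 * int j + 1)\<^sup>2 - (int p)\<^sup>2)) / of_int (16 * (int j + 1)\<^sup>2 - (int p)\<^sup>2)
      = of_nat (p ^ 2) * c"
    by (simp add: c_def J_def P_def)
  ultimately show "rat_cong ((of_int (2 * int j + 1) / of_int (2 * (int j + 1)))\<^sup>2)
      (of_int (4 * ((2 * int j + 1)\<^sup>2 - (int p)\<^sup>2)) / of_int (16 * (int j + 1)\<^sup>2 - (int p)\<^sup>2)) p 2"
    unfolding rat_cong_def by blast
qed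

text \<open>The cube splits as u * u^2: one copy of (1/2)_k / k! is common to both terms, and only
  the square is deformed, factor by factor from \<open>u j\<close> squared to \<open>v j\<close>.
  For j < k \<le> n one has j + 1 < p, as the factor congruence requires.\<close>

lemma strange_term_cong:
  assumes "prime p" "p = 2 * n + 1" "k \<le> n"
  shows "rat_cong ((6 * of_nat k + 1) * (pochhammer (1/2) k / fact k) ^ 3 * ((-1) ^ k / 8 ^ k))
    (strange_term n k) p 2"
proof -
  define u v :: "nat \<Rightarrow> rat"
    where "u = (\<lambda>j. of_int (2 * int j + 1) / of_int (2 * (int j + 1)))"
      and "v = (\<lambda>j. of_int (4 * ((2 * int j + 1)\<^sup>2 - (int p)\<^sup>2)) / of_int (16 * (int j + 1)\<^sup>2 - (int p)\<^sup>2))"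
  have factor: "rat_cong ((u j)\<^sup>2) (v j) p 2" "u j \<in> Z_localized p" "v j \<in> Z_localized p"
    if "j < k" for j
    unfolding u_def v_def
    using deformed_factor_cong[of p j] that assms
    \<comment> \<open>The deleted rules would push \<open>of_int\<close> inward and destroy the
      quotient shape that \<open>Z_localizedI\<close> matches.\<close>
    by (auto intro: Z_localizedI simp del: of_int_mult of_int_add of_int_diff of_int_power)
  have prod: "rat_cong (\<Prod>j<k. (u j)\<^sup>2) (\<Prod>j<k. v j) p 2"
    "(\<Prod>j<k. (u j)\<^sup>2) \<in> Z_localized p" "prod u {..<k} \<in> Z_localized p"
    using factor assms(1) by (auto intro!: rat_cong_prod Z_localized_prod Z_localized_power)
  have "\<not> int p dvd 8"
  proof
    assume "int p dvd 8"
    then have "int p dvd 2 ^ 3" by simp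
    then have "int p dvd 2" using assms(1) prime_dvd_power[of "int p" 2 3] by simp
    then show False using assms(2) zdvd_imp_le[of "int p" 2] prime_ge_2_nat[OF assms(1)] by auto
  qed
  then have "(-1/8 :: rat) \<in> Z_localized p"
    using Z_localizedI[of p 8 "-1"] by simp
  then have coeff: "(6 * of_nat k + 1) * prod u {..<k} * (-1/8) ^ k \<in> Z_localized p"
    using of_int_in_Z_localized[OF assms(1), of "6 * int k + 1"] prod(3) assms(1)
    by (simp add: Z_localized_mult Z_localized_power)
  have "(6 * of_nat k + 1) * (pochhammer (1/2) k / fact k) ^ 3 * ((-1) ^ k / 8 ^ k)
    = (6 * of_nat k + 1) * prod u {..<k} * (-1/8) ^ k * (\<Prod>j<k. (u j)\<^sup>2)"
    unfolding pochhammer_half_div_fact u_def[symmetric] prod_power_distrib[symmetric]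
    by (simp only: power_divide power3_eq_cube power2_eq_square prod.distrib mult_ac)
  moreover have "strange_term n k = (6 * of_nat k + 1) * prod u {..<k} * (-1/8) ^ k * (\<Prod>j<k. v j)"
    unfolding strange_term_prod[OF assms(2)] pochhammer_half_div_fact u_def v_def
    by (simp only: mult_ac)
  ultimately show ?thesis
    using rat_cong_mult[OF assms(1) rat_cong_refl[OF assms(1)] prod(1) coeff prod(2)] by simp
qed

text \<open>The exponent is n(n + 1)/2 + n. For n = 2m it is m(2m + 1) + 2m, for n = 2m + 1 it is
  (2m + 1)(m + 2); both have the parity of m.\<close>

lemma minus_one_power_triangular: "(-1 :: rat) ^ (((2 * n + 1)\<^sup>2 - 1) div 8 + n) = (-1) ^ (n div 2)"
proof -
  have sq: "(2 * n + 1)\<^sup>2 - 1 = 4 * (n * (n + 1))" by (simp add: power2_eq_square algebra_simps)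
  have half: "4 * (n * (n + 1)) div 8 = n * (n + 1) div 2" by simp
  have "even (n * (n + 1) div 2 + n) \<longleftrightarrow> even (n div 2)"
  proof (cases "even n")
    case True
    then obtain m where "n = 2 * m" by blast
    then show ?thesis by simp
  next
    case False
    then obtain m where m: "n = 2 * m + 1" by (auto elim: oddE)
    then have "n * (n + 1) = 2 * ((2 * m + 1) * (m + 1))" by simp
    then have "n * (n + 1) div 2 = (2 * m + 1) * (m + 1)" by simp
    then show ?thesis using m by simp
  qed
  then show ?thesis unfolding sq half by (simp add: minus_one_power_iff)
qed

theorem theorem4:
  fixes p :: nat
  assumes "prime p" and "p > 3"
  shows "rat_cong
    (\<Sum>k = 0..(p - 1) div 2.
       (6 * of_nat k + 1) * (pochhammer (1/2) k / fact k) ^ 3 * ((-1) ^ k / 8 ^ k))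
    ((-1) ^ ((p\<^sup>2 - 1) div 8 + (p - 1) div 2) * of_nat p)
    p 2"
proof -
  define n where "n = (p - 1) div 2"
  have p: "p = 2 * n + 1"
    using assms prime_odd_nat[of p] unfolding n_def by presburger
  \<comment> \<open>An exact equality, so the claim reduces to comparing the two sums term by
    term.\<close>
  have "(-1) ^ ((p\<^sup>2 - 1) div 8 + n) * of_nat p = (\<Sum>k = 0..n. strange_term n k)"
    using sum_strange_term[of n] minus_one_power_triangular[of n] by (simp add: p atLeast0AtMost)
  then show ?thesis
    unfolding n_def[symmetric]
    using rat_cong_sum[OF assms(1), of "{0..n}"] strange_term_cong[OF assms(1) p] by simp
qed

end
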